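(* Let $d\geq 1$ and let $e=(\mathbf e_1,\dots,\mathbf e_{q_1})$ and $f=(\mathbf f_1,\dots,\mathbf f_{q_2})$ be two disjoint sequences of nonzero vectors in $\mathbb N^d$ such that $\mathcal Q_{e,f}(\mathbf n)\in\mathbb Z$ for all $\mathbf n\in\mathbb N^d$ (equivalently $\Delta_{e,f}\geq 0$ on $[0,1]^d$), and suppose there exists $k\in\{1,\dots,d\}$ with $|e|^{(k)}>|f|^{(k)}$. Then: (a) there are only finitely many primes $p$ such that $q_{e,f,k}(\mathbf z)\in z_k\mathbb Z_p[[\mathbf z]]$; (b) for every $\mathbf L\in\mathcal E_{e,f}$ with $\mathbf L^{(k)}\geq 1$, there are only finitely many primes $p$ such that $q_{\mathbf L,e,f}(\mathbf z)\in\mathbb Z_p[[\mathbf z]]$.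
   Context: Notation: $\mathbf z=(z_1,\dots,z_d)$, $\mathbf z^{\mathbf n}=z_1^{n_1}\cdots z_d^{n_d}$, $\mathbf m\cdot\mathbf n$ the scalar product, $\mathbf m^{(k)}$ the $k$-th coordinate, $\mathbf m\geq\mathbf n$ coordinatewise. $|e|=\sum_i\mathbf e_i$, $|f|=\sum_j\mathbf f_j$, $\mathcal Q_{e,f}(\mathbf n)=\frac{\prod_{i}(\mathbf e_i\cdot\mathbf n)!}{\prod_j(\mathbf f_j\cdot\mathbf n)!}$, $H_m=\sum_{i=1}^m1/i$. $F_{e,f}(\mathbf z)=\sum_{\mathbf n\geq\mathbf 0}\mathcal Q_{e,f}(\mathbf n)\mathbf z^{\mathbf n}$, $G_{e,f,k}(\mathbf z)=\sum_{\mathbf n\geq\mathbf 0}\mathcal Q_{e,f}(\mathbf n)\big(\sum_{i=1}^{q_1}\mathbf e_i^{(k)}H_{\mathbf e_i\cdot\mathbf n}-\sum_{j=1}^{q_2}\mathbf f_j^{(k)}H_{\mathbf f_j\cdot\mathbf n}\big)\mathbf z^{\mathbf n}$, $q_{e,f,k}(\mathbf z)=z_k\exp(G_{e,f,k}/F_{e,f})$; $G_{\mathbf L,e,f}(\mathbf z)=\sum_{\mathbf n\geq\mathbf 0}\mathcal Q_{e,f}(\mathbf n)H_{\mathbf L\cdot\mathbf n}\mathbf z^{\mathbf n}$, $q_{\mathbf L,e,f}(\mathbf z)=\exp(G_{\mathbf L,e,f}/F_{e,f})$. $\Delta_{e,f}(\mathbf x)=\sum_i\lfloor\mathbf e_i\cdot\mathbf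 x\rfloor-\sum_j\lfloor\mathbf f_j\cdot\mathbf x\rfloor$. $\mathcal E_{e,f}$ is the set of $\mathbf L\in\mathbb N^d\setminus\{\mathbf 0\}$ such that $\mathbf L\leq\mathbf d$ for some $\mathbf d\in\{\mathbf e_1,\dots,\mathbf e_{q_1},\mathbf f_1,\dots,\mathbf f_{q_2}\}$. *)

theory Defs
  imports
    "HOL-Analysis.Finite_Cartesian_Product"
    "HOL-Computational_Algebra.Formal_Power_Series"
    "HOL-Computational_Algebra.Primes"
begin

unbundle no fps_syntax

section \<open>Formal power series in finitely many variables\<close>

text \<open>The variables are indexed by the finite type \<open>'d\<close>; a series is the family of its
  coefficients, indexed by the exponent vectors in \<open>nat ^ 'd\<close>.\<close>

typedef ('a, 'd :: finite) mfps = "UNIV :: (nat ^ 'd \<Rightarrow> 'a) set"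
  morphisms mcoeff Abs_mfps
  by simp

lemma mfps_eqI: "(\<And>n. mcoeff f n = mcoeff g n) \<Longrightarrow> f = g"
  by (metis ext mcoeff_inject)

lemma mcoeff_Abs_mfps [simp]: "mcoeff (Abs_mfps f) n = f n"
  by (simp add: Abs_mfps_inverse)

lemma finite_antidiagonal: "finite {(a, b). a + b = (n :: nat ^ 'd :: finite)}"
proof -
  have "finite {a. \<forall>i. a $ i \<in> {..n $ i}}"
  proof -
    have "{a. \<forall>i. a $ i \<in> {..n $ i}} = vec_lambda ` (PiE UNIV (\<lambda>i. {..n $ i}))"
      by (auto simp: image_iff intro!: bexI[of _ "vec_nth _"] simp: vec_lambda_beta)
    then show ?thesis by (simp add: finite_PiE)
  qed
  then have fin: "finite {a. a \<le> n}"
    by (simp add: less_eq_vec_def)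
  have "{(a, b). a + b = n} \<subseteq> {a. a \<le> n} \<times> {a. a \<le> n}"
    by (auto simp: less_eq_vec_def)
  then show ?thesis
    using fin finite_subset by blast
qed

instantiation mfps :: (comm_ring_1, finite) comm_ring_1
begin

definition "0 = Abs_mfps (\<lambda>_. 0)"
definition "1 = Abs_mfps (\<lambda>n. if n = 0 then 1 else 0)"
definition "f + g = Abs_mfps (\<lambda>n. mcoeff f n + mcoeff g n)"
definition "f - g = Abs_mfps (\<lambda>n. mcoeff f n - mcoeff g n)"
definition "- f = Abs_mfps (\<lambda>n. - mcoeff f n)"
definition "f * g = Abs_mfps (\<lambda>n. \<Sum>(a, b) | a + b = n. mcoeff f a * mcoeff g b)"

lemma mcoeff_simps:
  "mcoeff 0 n = 0"
  "mcoeff 1 n = (if n = 0 then 1 else 0)"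
  "mcoeff (f + g) n = mcoeff f n + mcoeff g n"
  "mcoeff (f - g) n = mcoeff f n - mcoeff g n"
  "mcoeff (- f) n = - mcoeff f n"
  by (simp_all add: zero_mfps_def one_mfps_def plus_mfps_def minus_mfps_def uminus_mfps_def)

lemma mcoeff_mult: "mcoeff (f * g) n = (\<Sum>(a, b) | a + b = n. mcoeff f a * mcoeff g b)"
  by (simp add: times_mfps_def)

instance
proof
  fix f g h :: "('a, 'b) mfps"
  show "f * g * h = f * (g * h)"
  proof (rule mfps_eqI)
    fix n
    have "mcoeff (f * g * h) n =
      (\<Sum>((x, c), (a, b)) \<in> (SIGMA (x, c) : {(x, c). x + c = n}. {(a, b). a + b = x}).
         mcoeff f a * mcoeff g b * mcoeff h c)"
      by (simp add: mcoeff_mult sum_distrib_right sum.Sigma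
          finite_antidiagonal[unfolded case_prod_unfold] case_prod_unfold)
    also have "\<dots> =
      (\<Sum>((a, x), (b, c)) \<in> (SIGMA (a, x) : {(a, x). a + x = n}. {(b, c). b + c = x}).
         mcoeff f a * (mcoeff g b * mcoeff h c))"
      by (rule sum.reindex_bij_witness
          [where i = "\<lambda>((a, x), (b, c)). ((a + b, c), (a, b))"
             and j = "\<lambda>((x, c), (a, b)). ((a, b + c), (b, c))"])
         (auto simp: ac_simps)
    also have "\<dots> = mcoeff (f * (g * h)) n"
      by (simp add: mcoeff_mult sum_distrib_left sum.Sigma
          finite_antidiagonal[unfolded case_prod_unfold] case_prod_unfold)
    finally show "mcoeff (f * g * h) n = mcoeff (f * (g * h)) n" .
  qed
  show "f * g = g * f"
    by (rule mfps_eqI, unfold mcoeff_mult,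
        rule sum.reindex_bij_witness[where i = prod.swap and j = prod.swap])
       (auto simp: ac_simps)
  show "1 * f = f"
  proof (rule mfps_eqI)
    fix n
    have "mcoeff (1 * f) n = (\<Sum>(a, b) \<in> {(0, n)}. mcoeff 1 a * mcoeff f b)"
      unfolding mcoeff_mult
      by (rule sum.mono_neutral_right) (auto simp: finite_antidiagonal mcoeff_simps split: if_splits)
    then show "mcoeff (1 * f) n = mcoeff f n"
      by (simp add: mcoeff_simps)
  qed
  show "(f + g) * h = f * h + g * h"
    by (rule mfps_eqI)
       (simp add: mcoeff_mult mcoeff_simps case_prod_unfold distrib_right sum.distrib)
  show "(0 :: ('a, 'b) mfps) \<noteq> 1"
  proof
    assume "(0 :: ('a, 'b) mfps) = 1"
    then have "mcoeff (0 :: ('a, 'b) mfps) 0 = mcoeff 1 0" by simp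
    then show False by (simp add: mcoeff_simps)
  qed
qed (rule mfps_eqI, simp add: mcoeff_simps algebra_simps)+

end

definition mfps_const :: "'a \<Rightarrow> ('a :: zero, 'd :: finite) mfps" where
  "mfps_const c = Abs_mfps (\<lambda>n. if n = 0 then c else 0)"

definition mfps_var :: "'d \<Rightarrow> ('a :: zero_neq_one, 'd :: finite) mfps" where
  "mfps_var k = Abs_mfps (\<lambda>n. if n = axis k 1 then 1 else 0)"

text \<open>Substitution \<open>\<Sum>k. a\<^sub>k A\<^sup>k\<close> of a series \<open>A\<close> with zero constant term into a univariate
  series. All monomials of \<open>A\<^sup>k\<close> then have total degree at least \<open>k\<close>, so the coefficient of
  \<open>z\<^sup>n\<close> only involves the powers \<open>k \<le> \<bar>n\<bar>\<close>.\<close>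

definition mfps_compose :: "'a fps \<Rightarrow> ('a, 'd) mfps \<Rightarrow> ('a :: comm_ring_1, 'd :: finite) mfps" where
  "mfps_compose a A =
     Abs_mfps (\<lambda>n. \<Sum>k\<le>(\<Sum>i\<in>UNIV. n $ i). fps_nth a k * mcoeff (A ^ k) n)"

definition mfps_exp :: "('a, 'd) mfps \<Rightarrow> ('a :: field_char_0, 'd :: finite) mfps" where
  "mfps_exp A = mfps_compose (fps_exp 1) A"

text \<open>The inverse of a series with constant term \<open>c \<noteq> 0\<close> is \<open>c\<^sup>-\<^sup>1 \<Sum>k. (1 - c\<^sup>-\<^sup>1 F)\<^sup>k\<close>; series with
  zero constant term get the inverse 0.\<close>

instantiation mfps :: (field, finite) inverse
begin

definition inverse_mfps :: "('a, 'b) mfps \<Rightarrow> ('a, 'b) mfps" where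
  "inverse F = (let c = mfps_const (inverse (mcoeff F 0))
                in c * mfps_compose (Abs_fps (\<lambda>_. 1)) (1 - c * F))"

definition divide_mfps :: "('a, 'b) mfps \<Rightarrow> ('a, 'b) mfps \<Rightarrow> ('a, 'b) mfps" where
  "divide_mfps G F = G * inverse F"

instance ..

end

lemma mcoeff_power_eq_0:
  fixes A :: "('a :: comm_ring_1, 'd :: finite) mfps"
  assumes "mcoeff A 0 = 0" and "(\<Sum>i\<in>UNIV. n $ i) < k"
  shows "mcoeff (A ^ k) n = 0"
  using assms(2)
proof (induction k arbitrary: n)
  case 0
  then show ?case by simp
next
  case (Suc k)
  have "mcoeff A a * mcoeff (A ^ k) b = 0" if ab: "a + b = n" for a b
  proof (cases "a = 0")
    case True
    then show ?thesis using assms(1) by simp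
  next
    case False
    then obtain i where "a $ i \<noteq> 0" by (auto simp: vec_eq_iff)
    then have "(\<Sum>i\<in>UNIV. a $ i) > 0" by (meson finite iso_tuple_UNIV_I neq0_conv sum_eq_0_iff)
    moreover have "(\<Sum>i\<in>UNIV. n $ i) = (\<Sum>i\<in>UNIV. a $ i) + (\<Sum>i\<in>UNIV. b $ i)"
      using ab by (auto simp: sum.distrib)
    ultimately have "(\<Sum>i\<in>UNIV. b $ i) < k" using Suc.prems by linarith
    then show ?thesis using Suc.IH by simp
  qed
  then show ?case by (auto simp: mcoeff_mult intro!: sum.neutral)
qed

lemma mfps_geometric:
  fixes A :: "('a :: comm_ring_1, 'd :: finite) mfps"
  assumes "mcoeff A 0 = 0"
  shows "(1 - A) * mfps_compose (Abs_fps (\<lambda>_. 1)) A = 1"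
proof (rule mfps_eqI)
  fix n :: "nat ^ 'd"
  let ?C = "mfps_compose (Abs_fps (\<lambda>_. 1)) A"
  let ?N = "\<Sum>i\<in>UNIV. n $ i"
  have C: "mcoeff ?C b = (\<Sum>k\<le>?N. mcoeff (A ^ k) b)" if ab: "a + b = n" for a b
  proof -
    have "?N = (\<Sum>i\<in>UNIV. a $ i) + (\<Sum>i\<in>UNIV. b $ i)"
      using ab by (auto simp: sum.distrib)
    then have "(\<Sum>k\<le>(\<Sum>i\<in>UNIV. b $ i). mcoeff (A ^ k) b) = (\<Sum>k\<le>?N. mcoeff (A ^ k) b)"
      by (intro sum.mono_neutral_left) (auto intro: mcoeff_power_eq_0[OF assms])
    then show ?thesis by (simp add: mfps_compose_def)
  qed
  have "mcoeff (A * ?C) n = (\<Sum>(a, b) | a + b = n. \<Sum>k\<le>?N. mcoeff A a * mcoeff (A ^ k) b)"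
    unfolding mcoeff_mult by (intro sum.cong) (auto simp: C sum_distrib_left)
  also have "\<dots> = (\<Sum>k\<le>?N. mcoeff (A ^ Suc k) n)"
    by (simp add: mcoeff_mult case_prod_unfold sum.swap[of _ "{..?N}"])
  finally have "mcoeff ((1 - A) * ?C) n =
      (\<Sum>k\<le>?N. mcoeff (A ^ k) n) - (\<Sum>k\<le>?N. mcoeff (A ^ Suc k) n)"
    using C[of 0 n] by (simp add: left_diff_distrib mcoeff_simps)
  also have "\<dots> = mcoeff (A ^ 0) n - mcoeff (A ^ Suc ?N) n"
    using sum_telescope[of "\<lambda>k. mcoeff (A ^ k) n" ?N] by (simp only: sum_subtractf)
  also have "\<dots> = mcoeff 1 n"
    using mcoeff_power_eq_0[OF assms, of n "Suc ?N"] by simp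
  finally show "mcoeff ((1 - A) * ?C) n = mcoeff 1 n" .
qed

lemma mfps_mult_inverse:
  fixes F :: "('a :: field, 'd :: finite) mfps"
  assumes "mcoeff F 0 \<noteq> 0"
  shows "F * inverse F = 1"
proof -
  define c :: "('a, 'd) mfps" where "c = mfps_const (inverse (mcoeff F 0))"
  have "{(a, b). a + b = (0 :: nat ^ 'd)} = {(0, 0)}"
    by (auto simp: vec_eq_iff)
  then have "mcoeff (1 - c * F) 0 = 0"
    using assms by (simp add: mcoeff_simps mcoeff_mult c_def mfps_const_def)
  from mfps_geometric[OF this] show ?thesis
    by (simp add: inverse_mfps_def Let_def ac_simps flip: c_def)
qed

section \<open>Rational \<open>p\<close>-adic integers\<close>

definition padic_val :: "nat \<Rightarrow> rat \<Rightarrow> int" where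
  "padic_val p x = (case quotient_of x of (a, b) \<Rightarrow>
     int (multiplicity (int p) a) - int (multiplicity (int p) b))"

text \<open>\<open>\<rat> \<inter> \<int>\<^sub>p\<close>, and the series over \<open>\<rat>\<close> all of whose coefficients lie in \<open>\<int>\<^sub>p\<close>\<close>

definition padic_ints :: "nat \<Rightarrow> rat set" where
  "padic_ints p = {x. x = 0 \<or> padic_val p x \<ge> 0}"

definition padic_int_series :: "nat \<Rightarrow> (rat, 'd :: finite) mfps set" where
  "padic_int_series p = {f. \<forall>n. mcoeff f n \<in> padic_ints p}"

section \<open>Factorial ratios and mirror maps\<close>

definition harmonic :: "nat \<Rightarrow> rat" where
  "harmonic m = (\<Sum>i = 1..m. 1 / of_nat i)"

definition fact_ratio :: "(nat ^ 'd) list \<Rightarrow> (nat ^ 'd) list \<Rightarrow> nat ^ 'd \<Rightarrow> rat" where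
  "fact_ratio e f n =
     (\<Prod>v\<leftarrow>e. fact (scalar_product v n)) / (\<Prod>v\<leftarrow>f. fact (scalar_product v n))"

definition F_series :: "(nat ^ 'd) list \<Rightarrow> (nat ^ 'd) list \<Rightarrow> (rat, 'd :: finite) mfps" where
  "F_series e f = Abs_mfps (fact_ratio e f)"

definition G_series :: "(nat ^ 'd) list \<Rightarrow> (nat ^ 'd) list \<Rightarrow> 'd \<Rightarrow> (rat, 'd :: finite) mfps" where
  "G_series e f k = Abs_mfps (\<lambda>n. fact_ratio e f n *
     ((\<Sum>v\<leftarrow>e. of_nat (v $ k) * harmonic (scalar_product v n)) -
      (\<Sum>v\<leftarrow>f. of_nat (v $ k) * harmonic (scalar_product v n))))"

definition q_series :: "(nat ^ 'd) list \<Rightarrow> (nat ^ 'd) list \<Rightarrow> 'd \<Rightarrow> (rat, 'd :: finite) mfps" where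
  "q_series e f k = mfps_var k * mfps_exp (G_series e f k / F_series e f)"

definition GL_series ::
  "nat ^ 'd \<Rightarrow> (nat ^ 'd) list \<Rightarrow> (nat ^ 'd) list \<Rightarrow> (rat, 'd :: finite) mfps" where
  "GL_series L e f = Abs_mfps (\<lambda>n. fact_ratio e f n * harmonic (scalar_product L n))"

definition qL_series ::
  "nat ^ 'd \<Rightarrow> (nat ^ 'd) list \<Rightarrow> (nat ^ 'd) list \<Rightarrow> (rat, 'd :: finite) mfps" where
  "qL_series L e f = mfps_exp (GL_series L e f / F_series e f)"

definition E_set :: "(nat ^ 'd) list \<Rightarrow> (nat ^ 'd) list \<Rightarrow> (nat ^ 'd :: finite) set" where
  "E_set e f = {L. L \<noteq> 0 \<and> (\<exists>v \<in> set e \<union> set f. L \<le> v)}"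

lemma mcoeff_series_0:
  "mcoeff (F_series e f) 0 = 1" "mcoeff (G_series e f k) 0 = 0" "mcoeff (GL_series L e f) 0 = 0"
proof -
  have [simp]: "scalar_product v 0 = 0" for v :: "nat ^ 'c"
    by (simp add: scalar_product_def)
  have [simp]: "(\<Prod>v\<leftarrow>xs. 1) = (1 :: rat)" for xs :: "(nat ^ 'c) list"
    by (induction xs) auto
  show "mcoeff (F_series e f) 0 = 1" "mcoeff (G_series e f k) 0 = 0"
    "mcoeff (GL_series L e f) 0 = 0"
    by (simp_all add: F_series_def G_series_def GL_series_def fact_ratio_def harmonic_def)
qed

end

theory Submission
  imports Defs
begin

text \<open>Setting all variables but \<open>z\<^sub>k\<close> to zero reduces everything to one variable. There, write \<open>h\<close> for
  \<open>G / F\<close>. If \<open>exp h\<close> is \<open>p\<close>-integral then so is its logarithmic derivative \<open>h'\<close>, hence the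
  coefficients of \<open>h\<close> in degrees below \<open>p\<close> are \<open>p\<close>-integral. Since \<open>|e|\<^sup>(\<^sup>k\<^sup>) > |f|\<^sup>(\<^sup>k\<^sup>)\<close>, the prime \<open>p\<close>
  divides \<open>Q(p)\<close>, which compensates the denominator \<open>p\<close> of the harmonic numbers and makes the
  coefficient of \<open>h\<close> in degree \<open>p\<close> integral too. In the coefficient of \<open>exp h\<close> in degree \<open>p\<close> only the term
  \<open>h\<^sub>1\<^sup>p / p!\<close> is then left, so \<open>p\<close> divides the numerator of \<open>h\<^sub>1\<close>. Finally \<open>h\<^sub>1 = G\<^sub>1\<close> does not
  depend on \<open>p\<close>, and it is nonzero because of Landau's criterion \<open>\<Delta> \<ge> 0\<close>.\<close>

unbundle fps_syntax and no vec_syntax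

section \<open>The ring of rational p-adic integers\<close>

text \<open>The denominator of the reduced fraction divides that of every other representation, so
  any fraction with denominator prime to \<open>p\<close> will do. The closure properties rely on
  this freedom.\<close>

lemma padic_ints_iff:
  assumes "prime p"
  shows "x \<in> padic_ints p \<longleftrightarrow> (\<exists>a b. x = of_int a / of_int b \<and> \<not> int p dvd b)"
proof
  obtain a b where q: "quotient_of x = (a, b)" by fastforce
  then have x: "x = of_int a / of_int b" and b: "b > 0" and cop: "coprime a b"
    by (auto simp: quotient_of_div quotient_of_denom_pos quotient_of_coprime)
  have P: "prime (int p)" using assms by simp
  show "\<exists>a b. x = of_int a / of_int b \<and> \<not> int p dvd b" if "x \<in> padic_ints p"
  proof (cases "x = 0")
    case True
    then show ?thesis using P by (intro exI[of _ 0] exI[of _ 1]) auto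
  next
    case False
    have "\<not> int p dvd b"
    proof
      assume pb: "int p dvd b"
      then have "\<not> int p dvd a" using cop P by (metis coprime_common_divisor not_prime_unit)
      then have "multiplicity (int p) a = 0" by (rule not_dvd_imp_multiplicity_0)
      moreover have "multiplicity (int p) b > 0"
        using pb b P by (simp add: prime_multiplicity_gt_zero_iff)
      ultimately show False using that False q by (simp add: padic_ints_def padic_val_def)
    qed
    with x show ?thesis by blast
  qed
  show "x \<in> padic_ints p" if "\<exists>a b. x = of_int a / of_int b \<and> \<not> int p dvd b"
  proof -
    from that obtain c d where x': "x = of_int c / of_int d" and d: "\<not> int p dvd d" by blast
    then have "d \<noteq> 0" by auto
    have "of_int a * of_int d = (of_int c * of_int b :: rat)"
      using x x' b \<open>d \<noteq> 0\<close> by (simp add: field_simps)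
    then have "a * d = c * b" by (metis of_int_eq_iff of_int_mult)
    then have "b dvd d"
      using cop by (metis coprime_commute coprime_dvd_mult_right_iff dvd_triv_right)
    then have "\<not> int p dvd b" using d dvd_trans by blast
    then show ?thesis
      using q by (simp add: padic_ints_def padic_val_def not_dvd_imp_multiplicity_0)
  qed
qed

context
  fixes p :: nat
  assumes prime_p: "prime p"
begin

lemma padic_ints_of_int: "of_int a \<in> padic_ints p"
  unfolding padic_ints_iff[OF prime_p] using prime_p
  by (intro exI[of _ a] exI[of _ 1]) auto

lemma padic_ints_Ints: "x \<in> \<int> \<Longrightarrow> x \<in> padic_ints p"
  by (auto elim!: Ints_cases simp: padic_ints_of_int)

lemma padic_ints_0: "0 \<in> padic_ints p" and padic_ints_1: "1 \<in> padic_ints p"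
  and padic_ints_of_nat: "of_nat m \<in> padic_ints p"
  by (auto intro: padic_ints_Ints)

lemma padic_ints_inverse_of_nat: "\<not> p dvd m \<Longrightarrow> 1 / of_nat m \<in> padic_ints p"
  unfolding padic_ints_iff[OF prime_p] by (intro exI[of _ 1] exI[of _ "int m"]) auto

lemma padic_ints_mult:
  assumes "x \<in> padic_ints p" "y \<in> padic_ints p"
  shows "x * y \<in> padic_ints p"
proof -
  from assms obtain a b c d where "x = of_int a / of_int b" "\<not> int p dvd b"
    "y = of_int c / of_int d" "\<not> int p dvd d" unfolding padic_ints_iff[OF prime_p] by blast
  then show ?thesis unfolding padic_ints_iff[OF prime_p] using prime_p
    by (intro exI[of _ "a * c"] exI[of _ "b * d"]) (auto simp: prime_dvd_mult_iff)
qed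

lemma padic_ints_add:
  assumes "x \<in> padic_ints p" "y \<in> padic_ints p"
  shows "x + y \<in> padic_ints p"
proof -
  from assms obtain a b c d where *: "x = of_int a / of_int b" "\<not> int p dvd b"
    "y = of_int c / of_int d" "\<not> int p dvd d" unfolding padic_ints_iff[OF prime_p] by blast
  then have "b \<noteq> 0" "d \<noteq> 0" by auto
  with * show ?thesis unfolding padic_ints_iff[OF prime_p] using prime_p
    by (intro exI[of _ "a * d + c * b"] exI[of _ "b * d"])
       (auto simp: prime_dvd_mult_iff add_frac_eq)
qed

lemma padic_ints_diff:
  assumes "x \<in> padic_ints p" "y \<in> padic_ints p"
  shows "x - y \<in> padic_ints p"
  using padic_ints_add[OF assms(1) padic_ints_mult[OF padic_ints_of_int[of "-1"] assms(2)]]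
  by simp

lemma padic_ints_sum: "(\<And>i. i \<in> A \<Longrightarrow> g i \<in> padic_ints p) \<Longrightarrow> sum g A \<in> padic_ints p"
  by (induction A rule: infinite_finite_induct) (auto intro: padic_ints_0 padic_ints_add)

lemma padic_ints_sum_list:
  "(\<And>i. i \<in> set xs \<Longrightarrow> g i \<in> padic_ints p) \<Longrightarrow> (\<Sum>i\<leftarrow>xs. g i) \<in> padic_ints p"
  by (induction xs) (auto intro: padic_ints_0 padic_ints_add)

lemma padic_ints_cancel_of_nat:
  assumes "of_nat m * x \<in> padic_ints p" "\<not> p dvd m"
  shows "x \<in> padic_ints p"
proof -
  have "m \<noteq> 0" using assms(2) by (intro notI) simp
  with padic_ints_mult[OF padic_ints_inverse_of_nat[OF assms(2)] assms(1)] show ?thesis by simp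
qed

section \<open>Powers and exponentials of univariate series with integral coefficients\<close>

lemma padic_ints_fps_power:
  fixes h :: "rat fps"
  assumes "\<And>j. j \<le> m \<Longrightarrow> h $ j \<in> padic_ints p" and "i \<le> m"
  shows "(h ^ j) $ i \<in> padic_ints p"
  using assms(2)
proof (induction j arbitrary: i)
  case 0
  then show ?case by (auto intro: padic_ints_0 padic_ints_1)
next
  case (Suc j)
  then show ?case
    by (auto simp: fps_mult_nth intro!: padic_ints_sum padic_ints_mult assms(1))
qed

text \<open>The logarithmic derivative \<open>h'\<close> of \<open>exp h\<close> is integral as soon as \<open>exp h\<close> is.\<close>

lemma padic_ints_exp_log_deriv:
  fixes h :: "rat fps"
  assumes h0: "h $ 0 = 0" and int: "\<And>j. (fps_exp 1 oo h) $ j \<in> padic_ints p"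
  shows "of_nat m * h $ m \<in> padic_ints p"
proof -
  define y where "y = fps_exp 1 oo h"
  have y: "y $ j \<in> padic_ints p" for j using int by (simp add: y_def)
  have y0: "y $ 0 = 1" by (simp add: y_def)
  have "fps_deriv y = y * fps_deriv h"
    unfolding y_def using h0 by (simp add: fps_compose_deriv)
  then have "fps_deriv y $ j = (fps_deriv h * y) $ j" for j by (simp add: mult.commute)
  then have eq: "of_nat (Suc j) * y $ Suc j = (\<Sum>i\<le>j. of_nat (Suc i) * h $ Suc i * y $ (j - i))" for j
    by (simp add: fps_mult_nth atLeast0AtMost del: of_nat_Suc)
  have "of_nat (Suc j) * h $ Suc j \<in> padic_ints p" for j
  proof (induction j rule: less_induct)
    case (less j)
    \<comment> \<open>Since \<open>y $ 0 = 1\<close>, the newest coefficient of \<open>h'\<close>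
      occurs with factor 1 and can be solved for without division.\<close>
    have "(\<Sum>i\<le>j. of_nat (Suc i) * h $ Suc i * y $ (j - i)) =
        (\<Sum>i<j. of_nat (Suc i) * h $ Suc i * y $ (j - i)) + of_nat (Suc j) * h $ Suc j"
      using y0 by (simp add: lessThan_Suc_atMost[symmetric] del: of_nat_Suc)
    then have "of_nat (Suc j) * h $ Suc j =
        of_nat (Suc j) * y $ Suc j - (\<Sum>i<j. of_nat (Suc i) * h $ Suc i * y $ (j - i))"
      using eq[of j] by linarith
    also have "\<dots> \<in> padic_ints p"
      by (intro padic_ints_diff padic_ints_sum padic_ints_mult[OF less.IH y]
          padic_ints_mult[OF padic_ints_of_nat y]) simp
    finally show ?case .
  qed
  then show ?thesis by (cases m) (auto intro: padic_ints_0 simp del: of_nat_Suc)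
qed

text \<open>Here \<open>g\<close> and \<open>u\<close> are numerator and denominator of
  \<open>h\<close>. In degree \<open>p\<close> the logarithmic derivative controls only
  \<open>p\<close> times the coefficient of \<open>h\<close>, so integrality of \<open>h $ p\<close>
  is read off from \<open>h * u = g\<close> instead. In the exponential, the powers
  \<open>h ^ j\<close> with \<open>j < p\<close> then contribute integral terms, since
  \<open>p\<close> does not divide \<open>fact j\<close>.\<close>

lemma exp_integral_imp_linear_power:
  fixes h g u :: "rat fps"
  assumes h0: "h $ 0 = 0" and int: "\<And>j. (fps_exp 1 oo h) $ j \<in> padic_ints p"
    and g: "h * u = g" and u0: "u $ 0 = 1" and u: "\<And>j. u $ j \<in> padic_ints p"
    and gp: "g $ p \<in> padic_ints p"
  shows "(g $ 1) ^ p / fact p \<in> padic_ints p"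
proof -
  have hlt: "h $ j \<in> padic_ints p" if "j < p" for j
  proof (cases "j = 0")
    case False
    then have "\<not> p dvd j" using that by (auto dest: dvd_imp_le)
    then show ?thesis
      using padic_ints_cancel_of_nat padic_ints_exp_log_deriv[OF h0 int] by blast
  qed (auto simp: h0 padic_ints_0)
  have "g $ p = (\<Sum>j<p. h $ j * u $ (p - j)) + h $ p"
    unfolding g[symmetric] fps_mult_nth
    by (simp add: atLeast0AtMost lessThan_Suc_atMost[symmetric] u0)
  then have "h $ p = g $ p - (\<Sum>j<p. h $ j * u $ (p - j))" by simp
  also have "\<dots> \<in> padic_ints p"
    by (intro padic_ints_diff gp padic_ints_sum padic_ints_mult u hlt) auto
  finally have hle: "h $ j \<in> padic_ints p" if "j \<le> p" for j
    using that hlt by (cases "j = p") auto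
  have g1: "g $ 1 = h $ 1"
    unfolding g[symmetric] fps_mult_nth by (simp add: h0 u0)
  have "(fps_exp 1 oo h) $ p = (\<Sum>j<p. (h ^ j) $ p * (1 / of_nat (fact j))) + (h ^ p) $ p / fact p"
    by (simp add: fps_compose_nth atLeast0AtMost lessThan_Suc_atMost[symmetric])
  moreover have "(h ^ p) $ p = (h $ 1) ^ p"
    using h0 by (simp add: startsby_zero_power_nth_same)
  ultimately have "(g $ 1) ^ p / fact p =
      (fps_exp 1 oo h) $ p - (\<Sum>j<p. (h ^ j) $ p * (1 / of_nat (fact j)))"
    using g1 by simp
  also have "\<dots> \<in> padic_ints p"
    using prime_p
    by (intro padic_ints_diff int padic_ints_sum padic_ints_mult padic_ints_fps_power[of p]
        padic_ints_inverse_of_nat hle) (auto simp: prime_dvd_fact_iff)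
  finally show ?thesis .
qed

end

text \<open>Since \<open>p\<close> divides \<open>fact p\<close>, integrality forces
  \<open>p\<close> to divide the nonzero numerator of \<open>x\<close>, which bounds
  \<open>p\<close>.\<close>

lemma finite_primes_power_over_fact:
  fixes x :: rat
  assumes "x \<noteq> 0"
  shows "finite {p. prime p \<and> x ^ p / fact p \<in> padic_ints p}"
proof -
  obtain a b where q: "quotient_of x = (a, b)" by fastforce
  then have x: "x = of_int a / of_int b" and b: "b > 0"
    by (auto simp: quotient_of_div quotient_of_denom_pos)
  with assms have a: "a \<noteq> 0" by auto
  have "p \<le> nat \<bar>a\<bar>" if p: "prime p" and "x ^ p / fact p \<in> padic_ints p" for p
  proof -
    from that obtain c d where cd: "x ^ p / fact p = of_int c / of_int d" "\<not> int p dvd d"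
      by (auto simp: padic_ints_iff)
    then have "d \<noteq> 0" by auto
    then have "of_int (a ^ p * d) = (of_int (c * b ^ p * fact p) :: rat)"
      using cd x b by (simp add: power_divide field_simps)
    then have "a ^ p * d = c * b ^ p * fact p" by (simp only: of_int_eq_iff)
    moreover have "int p dvd fact p"
      using p by (metis dvd_fact of_nat_dvd_iff of_nat_fact order_refl prime_ge_1_nat)
    ultimately have "int p dvd a ^ p * d" by simp
    then have "int p dvd a" using cd(2) p
      by (meson prime_dvd_mult_iff prime_dvd_power prime_nat_int_transfer)
    then have "int p \<le> \<bar>a\<bar>" using a by (metis abs_of_nat dvd_imp_le_int)
    then show ?thesis by simp
  qed
  then have "{p. prime p \<and> x ^ p / fact p \<in> padic_ints p} \<subseteq> {..nat \<bar>a\<bar>}" by blast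
  then show ?thesis using finite_subset by blast
qed


unbundle no fps_syntax and vec_syntax

section \<open>Factorial ratios in one variable and Landau's criterion\<close>

text \<open>This is the factorial ratio on the axis of \<open>z\<^sub>k\<close>: the lists will hold
  the \<open>k\<close>-th coordinates of the vectors, so zeros are allowed.\<close>

definition univ_ratio :: "nat list \<Rightarrow> nat list \<Rightarrow> nat \<Rightarrow> rat" where
  "univ_ratio as bs n = (\<Prod>a\<leftarrow>as. fact (a * n)) / (\<Prod>b\<leftarrow>bs. fact (b * n))"

text \<open>Legendre's formula reduced to its first term: below \<open>p\<^sup>2\<close> a positive
  multiple of \<open>p\<close> is divisible by \<open>p\<close> just once.\<close>

lemma fact_eq_prime_power_mult:
  fixes p n :: nat
  assumes "prime p" "n < p\<^sup>2"
  shows "\<exists>u. fact n = p ^ (n div p) * u \<and> \<not> p dvd u"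
  using assms(2)
proof (induction n)
  case 0
  then show ?case using assms(1) by auto
next
  case (Suc n)
  then obtain u where u: "fact n = p ^ (n div p) * u" "\<not> p dvd u" by auto
  show ?case
  proof (cases "p dvd Suc n")
    case True
    then obtain c where c: "Suc n = p * c" by auto
    have "p * c < p * p" using Suc.prems unfolding c power2_eq_square .
    then have "c < p" by (metis mult_less_cancel1)
    moreover have "c > 0" using c by (cases c) auto
    ultimately have "\<not> p dvd c" by (auto dest: dvd_imp_le)
    moreover have "Suc n div p = Suc (n div p)" using True by (auto simp: div_Suc)
    moreover have "fact (Suc n) = (p * c) * fact n" by (metis c fact_Suc of_nat_id)
    ultimately show ?thesis using u assms(1)
      by (intro exI[of _ "c * u"]) (simp add: prime_dvd_mult_iff del: fact_Suc)
  next
    case False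
    then have "Suc n div p = n div p" by (simp add: div_Suc dvd_eq_mod_eq_0)
    with False show ?thesis using u assms(1)
      by (intro exI[of _ "Suc n * u"]) (simp add: prime_dvd_mult_iff del: mult_Suc)
  qed
qed

lemma prod_list_fact_eq_prime_power_mult:
  fixes p n :: nat
  assumes "prime p" "\<And>a. a \<in> set as \<Longrightarrow> a * n < p\<^sup>2"
  shows "\<exists>u. (\<Prod>a\<leftarrow>as. fact (a * n)) = p ^ (\<Sum>a\<leftarrow>as. a * n div p) * u \<and> \<not> p dvd u"
  using assms(2)
proof (induction as)
  case Nil
  then show ?case using assms(1) by auto
next
  case (Cons a as)
  then obtain u where "(\<Prod>a\<leftarrow>as. fact (a * n)) = p ^ (\<Sum>a\<leftarrow>as. a * n div p) * u" "\<not> p dvd u"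
    by auto
  moreover obtain v where "fact (a * n) = p ^ (a * n div p) * v" "\<not> p dvd v"
    using fact_eq_prime_power_mult[OF assms(1), of "a * n"] Cons.prems by auto
  ultimately show ?case
    using assms(1) by (intro exI[of _ "v * u"]) (simp add: prime_dvd_mult_iff power_add)
qed

lemma univ_ratio_eq:
  assumes "prime p" "\<And>a. a \<in> set as \<union> set bs \<Longrightarrow> a * n < p\<^sup>2"
  obtains u v where "\<not> p dvd u" "\<not> p dvd v"
    "univ_ratio as bs n = of_nat (p ^ (\<Sum>a\<leftarrow>as. a * n div p) * u) /
       of_nat (p ^ (\<Sum>b\<leftarrow>bs. b * n div p) * v)"
proof -
  obtain u where u: "(\<Prod>a\<leftarrow>as. fact (a * n)) = p ^ (\<Sum>a\<leftarrow>as. a * n div p) * u" "\<not> p dvd u"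
    using prod_list_fact_eq_prime_power_mult[OF assms(1), of as n] assms(2) by auto
  obtain v where v: "(\<Prod>b\<leftarrow>bs. fact (b * n)) = p ^ (\<Sum>b\<leftarrow>bs. b * n div p) * v" "\<not> p dvd v"
    using prod_list_fact_eq_prime_power_mult[OF assms(1), of bs n] assms(2) by auto
  have "(\<Prod>a\<leftarrow>xs. fact (a * n)) = (of_nat (\<Prod>a\<leftarrow>xs. fact (a * n)) :: rat)" for xs
    by (induction xs) auto
  then show ?thesis using that u v unfolding univ_ratio_def by metis
qed

text \<open>The difference of the two sums is the \<open>p\<close>-adic valuation of the ratio,
  which cannot be negative for an integer. This is \<Delta> \<ge> 0 at the point
  \<open>n / p\<close>.\<close>

lemma univ_ratio_integral_imp_sum_div_le:
  assumes p: "prime p" "\<And>a. a \<in> set as \<union> set bs \<Longrightarrow> a * n < p\<^sup>2"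
    and int: "univ_ratio as bs n \<in> \<int>"
  shows "(\<Sum>b\<leftarrow>bs. b * n div p) \<le> (\<Sum>a\<leftarrow>as. a * n div p)"
proof (rule ccontr)
  define A B where "A = (\<Sum>a\<leftarrow>as. a * n div p)" and "B = (\<Sum>b\<leftarrow>bs. b * n div p)"
  assume "\<not> ?thesis"
  \<comment> \<open>The successor leaves one spare factor \<open>p\<close> after
    \<open>p ^ A\<close> has been cancelled.\<close>
  then have AB: "B = A + Suc (B - A - 1)" by (simp add: A_def B_def)
  obtain u v where uv: "\<not> p dvd u" "\<not> p dvd v"
    "univ_ratio as bs n = of_nat (p ^ A * u) / of_nat (p ^ B * v)"
    using univ_ratio_eq[OF p] unfolding A_def B_def by blast
  obtain z where "univ_ratio as bs n = of_int z" using int by (auto elim: Ints_cases)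
  moreover have "p ^ B * v \<noteq> 0" using uv p(1) by (auto intro: Nat.gr0I)
  ultimately have "of_int z * of_nat (p ^ B * v) = (of_nat (p ^ A * u) :: rat)"
    using uv(3) by (simp add: field_simps)
  then have "of_int (z * int (p ^ B * v)) = (of_int (int (p ^ A * u)) :: rat)"
    by (simp only: of_int_mult of_int_of_nat_eq)
  then have "z * int (p ^ B * v) = int (p ^ A * u)" by (simp only: of_int_eq_iff)
  then have "int (p ^ A) * (z * int (p ^ Suc (B - A - 1) * v)) = int (p ^ A) * int u"
    by (subst (asm) AB) (simp add: power_add algebra_simps)
  then have "z * int (p ^ Suc (B - A - 1) * v) = int u"
    using p(1) by (simp add: prime_gt_0_nat)
  then have "int p dvd int u"
    by (metis dvd_mult dvd_mult2 dvd_triv_left of_nat_mult power_Suc)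
  then show False using uv(1) by simp
qed

text \<open>Landau's criterion at the rational point \<open>t / M\<close>, which is approached from the right by
  fractions with a large prime denominator.\<close>

lemma univ_ratio_integral_imp_Landau:
  assumes int: "\<And>n. univ_ratio as bs n \<in> \<int>" and M: "M > 0"
  shows "(\<Sum>b\<leftarrow>bs. b * t div M) \<le> (\<Sum>a\<leftarrow>as. a * t div M)"
proof -
  define N where "N = sum_list as + sum_list bs + 1"
  have N: "a < N" if "a \<in> set as \<union> set bs" for a
    using that member_le_sum_list[of a as] member_le_sum_list[of a bs] by (auto simp: N_def)
  \<comment> \<open>The size of \<open>p\<close> serves twice: it yields both
    \<open>a * s < p\<^sup>2\<close> and \<open>a * M < p\<close> for every entry
    \<open>a\<close>.\<close>
  obtain p where p: "prime p" "N * M * (t + 1) < p" using bigger_prime by blast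
  \<comment> \<open>\<open>s / p\<close> is the first multiple of \<open>1 / p\<close> strictly to
    the right of \<open>t / M\<close>, so it exceeds \<open>t / M\<close> by at most
    \<open>1 / p\<close>.\<close>
  define s where "s = t * p div M + 1"
  have p0: "p > 0" using p by simp
  have s1: "t * p < s * M" unfolding s_def using M
    by (metis add.commute dividend_less_times_div mult.commute mult_Suc_right plus_1_eq_Suc)
  have s2: "s * M \<le> t * p + M" unfolding s_def by (simp add: add.commute)
  have "s \<le> t * p + 1" unfolding s_def by simp
  then have s3: "s \<le> (t + 1) * p" using p0 by (simp add: algebra_simps)
  have small: "a * s < p\<^sup>2" if "a \<in> set as \<union> set bs" for a
  proof -
    have "a * s \<le> N * ((t + 1) * p)" using N[OF that] s3 by (intro mult_mono) auto
    also have "\<dots> \<le> M * (N * ((t + 1) * p))" using M by simp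
    also have "\<dots> = (N * M * (t + 1)) * p" by (simp only: ac_simps)
    also have "\<dots> < p * p" using p p0 by (intro mult_strict_right_mono) auto
    finally show ?thesis by (simp add: power2_eq_square)
  qed
  \<comment> \<open>\<open>a * t / M\<close> lies at least \<open>1 / M\<close> below the next
    integer, while moving to \<open>s / p\<close> adds at most \<open>a / p < 1 / M\<close>. Hence
    the floor does not change.\<close>
  have eq: "a * s div p = a * t div M" if "a \<in> set as \<union> set bs" for a
  proof (rule div_nat_eqI)
    define q where "q = a * t div M"
    have "a * M \<le> N * M" using N[OF that] by simp
    also have "\<dots> \<le> N * M * (t + 1)" by simp
    finally have aM: "a * M < p" using p(2) by linarith
    have q1: "q * M \<le> a * t" unfolding q_def by simp
    have q2: "a * t + 1 \<le> (q + 1) * M" unfolding q_def using M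
      by (metis Suc_eq_plus1 Suc_leI dividend_less_times_div mult.commute mult_Suc)
    have "(q * p) * M \<le> (a * s) * M"
    proof -
      have "(q * p) * M = (q * M) * p" by simp
      also have "\<dots> \<le> (a * t) * p" using q1 by (rule mult_right_mono) simp
      also have "\<dots> = a * (t * p)" by simp
      also have "\<dots> \<le> a * (s * M)" using s1 by (intro mult_left_mono) auto
      finally show ?thesis by (simp only: ac_simps)
    qed
    then show "p * (a * t div M) \<le> a * s" using M by (simp add: q_def mult.commute)
    have "(a * s) * M < ((q + 1) * p) * M"
    proof -
      have "(a * s) * M = a * (s * M)" by simp
      also have "\<dots> \<le> a * (t * p + M)" using s2 by (intro mult_left_mono) auto
      also have "\<dots> = a * t * p + a * M" by (simp add: algebra_simps)
      also have "\<dots> < a * t * p + p" using aM by simp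
      also have "\<dots> = (a * t + 1) * p" by simp
      also have "\<dots> \<le> ((q + 1) * M) * p" using q2 by (rule mult_right_mono) simp
      finally show ?thesis by (simp only: ac_simps)
    qed
    then have "a * s < (q + 1) * p" by (metis mult_less_cancel2)
    then show "a * s < p * Suc (a * t div M)" by (simp add: q_def mult.commute)
  qed
  have "(\<Sum>b\<leftarrow>bs. b * s div p) \<le> (\<Sum>a\<leftarrow>as. a * s div p)"
    using univ_ratio_integral_imp_sum_div_le[OF p(1) small int] by blast
  moreover have "map (\<lambda>a. a * s div p) as = map (\<lambda>a. a * t div M) as"
    "map (\<lambda>a. a * s div p) bs = map (\<lambda>a. a * t div M) bs"
    using eq by auto
  ultimately show ?thesis by simp
qed

section \<open>Harmonic numbers and positivity of the linear coefficient\<close>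

text \<open>For \<open>a > 0\<close> the floor of \<open>a * t / M\<close> jumps, by one, exactly
  when \<open>M div a\<close> divides \<open>t\<close>. At \<open>t = i * (M div a)\<close> the
  weight \<open>M / t\<close> equals \<open>a / i\<close>, so the weighted jumps add up to
  \<open>a\<close> times the harmonic number.\<close>

lemma harmonic_eq_sum_jumps:
  assumes "M > 0" "a = 0 \<or> a dvd M"
  shows "of_nat a * harmonic a =
    (\<Sum>t=1..M. (of_nat (a * t div M) - of_nat (a * (t - 1) div M)) * (of_nat M / of_nat t))"
proof (cases "a = 0")
  case False
  with assms obtain c where c: "M = a * c" by auto
  with assms False have c0: "c > 0" and a0: "a > 0" by (auto intro: Nat.gr0I)
  have "(\<Sum>t=1..M. (of_nat (a * t div M) - of_nat (a * (t - 1) div M)) * (of_nat M / of_nat t)) =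
      (\<Sum>t=1..M. if c dvd t then of_nat M / of_nat t else (0 :: rat))"
  proof (rule sum.cong)
    fix t assume "t \<in> {1..M}"
    then obtain s where t: "t = Suc s" by (cases t) auto
    have "a * r div M = r div c" for r using c a0 by simp
    then show "(of_nat (a * t div M) - of_nat (a * (t - 1) div M)) * (of_nat M / of_nat t) =
      (if c dvd t then of_nat M / of_nat t else (0 :: rat))"
      by (simp add: t div_Suc dvd_eq_mod_eq_0 del: mult_Suc_right)
  qed simp
  also have "\<dots> = (\<Sum>t\<in>{t \<in> {1..M}. c dvd t}. of_nat M / of_nat t)"
    by (rule sum.inter_filter[symmetric]) simp
  also have "\<dots> = (\<Sum>i=1..a. of_nat a * (1 / of_nat i))"
    by (rule sum.reindex_bij_witness[where i = "\<lambda>i. c * i" and j = "\<lambda>t. t div c"])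
       (use c c0 in \<open>auto simp: mult.commute\<close>)
  finally show ?thesis by (simp add: harmonic_def sum_distrib_left)
qed simp

text \<open>A form of Abel summation: the induction step amounts to
  \<open>D n / (n + 1) \<le> D n / n\<close>, which is where nonnegativity enters. At
  \<open>n = 0\<close> the quotient is 0 by convention, and \<open>D 0 = 0\<close> keeps the first
  step valid.\<close>

lemma sum_increments_div_ge:
  fixes D :: "nat \<Rightarrow> rat"
  assumes "D 0 = 0" "\<And>t. D t \<ge> 0"
  shows "D n / of_nat n \<le> (\<Sum>t=1..n. (D t - D (t - 1)) * (1 / of_nat t))"
proof (induction n)
  case (Suc n)
  have "D n / of_nat (Suc n) \<le> D n / of_nat n"
    using assms by (cases "n = 0") (auto intro!: divide_left_mono)
  then have "D (Suc n) / of_nat (Suc n) \<le> D n / of_nat n + (D (Suc n) - D n) * (1 / of_nat (Suc n))"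
    by (simp add: diff_divide_distrib)
  with Suc.IH show ?case by simp
qed simp

text \<open>With \<open>\<Delta> x = (\<Sum>a. \<lfloor>a x\<rfloor>) - (\<Sum>b. \<lfloor>b x\<rfloor>)\<close> the difference is the Stieltjes integral of \<open>1 / x\<close>
  against \<open>\<Delta>\<close> over \<open>(0, 1]\<close>, hence at least \<open>\<Delta> 1\<close> because \<open>\<Delta> \<ge> 0\<close>.\<close>

lemma sum_harmonic_less:
  assumes int: "\<And>n. univ_ratio as bs n \<in> \<int>" and less: "sum_list bs < sum_list as"
  shows "(\<Sum>b\<leftarrow>bs. of_nat b * harmonic b) < (\<Sum>a\<leftarrow>as. of_nat a * harmonic a)"
proof -
  \<comment> \<open>A common multiple of all nonzero entries: every jump of \<Delta> on (0, 1] then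
    sits at some point \<open>t / M\<close>.\<close>
  define M :: nat where "M = fact (sum_list as + sum_list bs)"
  have M: "M > 0" by (simp add: M_def)
  have dvd: "a = 0 \<or> a dvd M" if "a \<in> set as \<union> set bs" for a
    using that member_le_sum_list[of a as] member_le_sum_list[of a bs]
    unfolding M_def by (cases "a = 0") (auto intro!: dvd_fact)
  define S :: "nat list \<Rightarrow> nat \<Rightarrow> rat" where "S xs t = of_nat (\<Sum>a\<leftarrow>xs. a * t div M)" for xs t
  have S: "(\<Sum>a\<leftarrow>xs. of_nat a * harmonic a) =
      (\<Sum>t=1..M. (S xs t - S xs (t - 1)) * (of_nat M / of_nat t))"
    if "\<forall>a\<in>set xs. a = 0 \<or> a dvd M" for xs
    using that
  proof (induction xs)
    case Nil
    then show ?case by (simp add: S_def)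
  next
    case (Cons a xs)
    then have IH: "(\<Sum>a\<leftarrow>xs. of_nat a * harmonic a) =
      (\<Sum>t=1..M. (S xs t - S xs (t - 1)) * (of_nat M / of_nat t))" by simp
    have "(\<Sum>a\<leftarrow>a # xs. of_nat a * harmonic a) =
      (\<Sum>t=1..M. (of_nat (a * t div M) - of_nat (a * (t - 1) div M)) * (of_nat M / of_nat t) +
         (S xs t - S xs (t - 1)) * (of_nat M / of_nat t))"
      using harmonic_eq_sum_jumps[OF M, of a] Cons.prems by (simp add: IH sum.distrib)
    also have "\<dots> = (\<Sum>t=1..M. (S (a # xs) t - S (a # xs) (t - 1)) * (of_nat M / of_nat t))"
      by (intro sum.cong refl) (simp only: S_def list.map sum_list.Cons of_nat_add, simp only: algebra_simps)
    finally show ?case .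
  qed
  \<comment> \<open>\<open>D t\<close> is \<Delta> at \<open>t / M\<close>; its last value
    \<open>D M\<close> is \<Delta> at 1, the positive number
    \<open>sum_list as - sum_list bs\<close>.\<close>
  define D where "D t = S as t - S bs t" for t
  have D0: "D 0 = 0" by (simp add: D_def S_def)
  have Dge: "D t \<ge> 0" for t
    using univ_ratio_integral_imp_Landau[OF int M, of t] by (simp add: D_def S_def)
  have "S xs M = of_nat (sum_list xs)" for xs
    using M by (simp add: S_def)
  then have "D M > 0" using less by (simp add: D_def)
  then have "0 < of_nat M * (D M / of_nat M)" using M by simp
  also have "\<dots> \<le> of_nat M * (\<Sum>t=1..M. (D t - D (t - 1)) * (1 / of_nat t))"
    using sum_increments_div_ge[of D, OF D0 Dge] by (intro mult_left_mono) auto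
  also have "\<dots> = (\<Sum>t=1..M. (S as t - S as (t - 1)) * (of_nat M / of_nat t)) -
      (\<Sum>t=1..M. (S bs t - S bs (t - 1)) * (of_nat M / of_nat t))"
    unfolding sum_distrib_left sum_subtractf[symmetric]
    by (intro sum.cong) (auto simp: D_def algebra_simps diff_divide_distrib)
  also have "\<dots> = (\<Sum>a\<leftarrow>as. of_nat a * harmonic a) - (\<Sum>b\<leftarrow>bs. of_nat b * harmonic b)"
    using S[of as] S[of bs] dvd by simp
  finally show ?thesis by simp
qed

section \<open>Valuations in degree p\<close>

text \<open>Each positive \<open>i\<close> below \<open>p\<^sup>2\<close> contains \<open>p\<close>
  at most once, so a single factor \<open>p\<close> clears the \<open>p\<close>-parts of all
  denominators.\<close>

lemma padic_ints_prime_mult_harmonic: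
  assumes p: "prime p" and m: "m < p\<^sup>2"
  shows "of_nat p * harmonic m \<in> padic_ints p"
proof -
  have "of_nat p * (1 / of_nat i) \<in> padic_ints p" if i: "i \<in> {1..m}" for i
  proof (cases "p dvd i")
    case True
    then obtain c where c: "i = p * c" by auto
    have "p > 0" using p prime_gt_0_nat by blast
    have "p * c < p * p" using i m unfolding c power2_eq_square atLeastAtMost_iff by linarith
    then have "c < p" by (metis mult_less_cancel1)
    moreover have "c > 0" using i c by (cases c) auto
    ultimately have "\<not> p dvd c" by (auto dest: dvd_imp_le)
    then show ?thesis using padic_ints_inverse_of_nat[OF p, of c] c \<open>p > 0\<close> by simp
  next
    case False
    then show ?thesis
      using padic_ints_mult[OF p padic_ints_of_nat[OF p] padic_ints_inverse_of_nat[OF p]] by blast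
  qed
  then show ?thesis unfolding harmonic_def sum_distrib_left by (intro padic_ints_sum p) auto
qed

text \<open>All entries are below \<open>p\<close>, so the valuation in degree \<open>p\<close> is
  exactly \<open>sum_list as - sum_list bs\<close>, hence at least one. This gain pays for the
  denominator \<open>p\<close> of the harmonic numbers.\<close>

lemma univ_ratio_prime:
  assumes p: "prime p" "sum_list as + sum_list bs < p" and less: "sum_list bs < sum_list as"
  shows "univ_ratio as bs p / of_nat p \<in> padic_ints p"
proof -
  have p0: "p > 0" using p prime_gt_0_nat by blast
  have "a < p" if "a \<in> set as \<union> set bs" for a
    using that p(2) member_le_sum_list[of a as] member_le_sum_list[of a bs] by auto
  then have small: "a * p < p\<^sup>2" if "a \<in> set as \<union> set bs" for a
    using that p0 by (simp add: power2_eq_square)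
  have "(\<Sum>a\<leftarrow>xs. a * p div p) = sum_list xs" for xs using p0 by simp
  then obtain u v where uv: "\<not> p dvd u" "\<not> p dvd v"
    "univ_ratio as bs p = of_nat (p ^ sum_list as * u) / of_nat (p ^ sum_list bs * v)"
    using univ_ratio_eq[OF p(1) small, of as bs] by metis
  \<comment> \<open>The gap is written as a successor because one factor \<open>p\<close> is spent
    on the division.\<close>
  obtain c where c: "sum_list as = sum_list bs + Suc c"
    using less less_imp_Suc_add by fastforce
  have "univ_ratio as bs p / of_nat p = of_nat (p ^ c * u) * (1 / of_nat v)"
    using p0 by (simp add: uv(3) c power_add)
  then show ?thesis
    using padic_ints_mult[OF p(1) padic_ints_of_nat[OF p(1)] padic_ints_inverse_of_nat[OF p(1) uv(2)]]
    by metis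
qed

section \<open>Restriction of a series to one coordinate axis\<close>

text \<open>This substitutes 0 for every variable except \<open>z\<^sub>k\<close>; landing in
  \<open>fps\<close> makes the univariate derivative and composition available.\<close>

definition mfps_axis :: "'d \<Rightarrow> ('a :: comm_ring_1, 'd :: finite) mfps \<Rightarrow> 'a fps" where
  "mfps_axis k A = Abs_fps (\<lambda>m. mcoeff A (axis k m))"

lemma mfps_axis_nth: "fps_nth (mfps_axis k A) m = mcoeff A (axis k m)"
  by (simp add: mfps_axis_def)

lemma axis_nat_nth: "(axis k m :: nat ^ 'd) $ i = (if i = k then m else 0)"
  by (auto simp: axis_def)

lemma axis_nat_0: "axis k (0 :: nat) = 0"
  by (simp add: vec_eq_iff axis_nat_nth)

text \<open>Exponents are natural numbers, so a sum of two of them lies on the axis only if both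
  summands do.\<close>

lemma mfps_axis_mult: "mfps_axis k (A * B) = mfps_axis k A * mfps_axis k B"
proof (rule fps_ext)
  fix m
  have "mcoeff (A * B) (axis k m) =
    (\<Sum>i=0..m. mcoeff A (axis k i) * mcoeff B (axis k (m - i)))"
    unfolding mcoeff_mult
  proof (rule sum.reindex_bij_witness
      [where i = "\<lambda>i. (axis k i, axis k (m - i))" and j = "\<lambda>(a, b). a $ k"])
    fix ab assume "ab \<in> {(a, b). a + b = axis k m}"
    then obtain a b where ab: "ab = (a, b)" "a + b = axis k m" by auto
    then have eq: "a $ i + b $ i = (if i = k then m else 0)" for i
      by (metis axis_nat_nth vector_add_component)
    have k: "a $ k + b $ k = m" using eq[of k] by simp
    have zero: "a $ i = 0" "b $ i = 0" if "i \<noteq> k" for i using eq[of i] that by simp_all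
    have "a = axis k (a $ k)" "b = axis k (m - a $ k)"
      using zero k by (auto simp: vec_eq_iff axis_nat_nth)
    with ab k show "(axis k (case ab of (a, b) \<Rightarrow> a $ k), axis k (m - (case ab of (a, b) \<Rightarrow> a $ k))) = ab"
      "(case ab of (a, b) \<Rightarrow> a $ k) \<in> {0..m}"
      "mcoeff A (axis k (case ab of (a, b) \<Rightarrow> a $ k)) *
       mcoeff B (axis k (m - (case ab of (a, b) \<Rightarrow> a $ k))) =
       (case ab of (a, b) \<Rightarrow> mcoeff A a * mcoeff B b)"
      by auto
  qed (auto simp: vec_eq_iff axis_nat_nth)
  then show "fps_nth (mfps_axis k (A * B)) m = fps_nth (mfps_axis k A * mfps_axis k B) m"
    by (simp add: mfps_axis_nth fps_mult_nth)
qed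

lemma mfps_axis_1: "mfps_axis k 1 = 1"
  by (rule fps_ext) (auto simp: mfps_axis_nth mcoeff_simps axis_nat_0 vec_eq_iff axis_nat_nth)

lemma mfps_axis_power: "mfps_axis k (A ^ m) = mfps_axis k A ^ m"
  by (induction m) (simp_all add: mfps_axis_1 mfps_axis_mult)

text \<open>The sum in \<open>mfps_compose\<close> stops at the total degree, which on the axis is
  \<open>m\<close>, exactly where univariate composition stops.\<close>

lemma mfps_axis_compose: "mfps_axis k (mfps_compose a A) = fps_compose a (mfps_axis k A)"
  by (rule fps_ext)
     (simp add: mfps_axis_nth mfps_compose_def fps_compose_nth axis_nat_nth atLeast0AtMost
       flip: mfps_axis_power)

lemma mcoeff_var_mult: "mcoeff (mfps_var k * A) (axis k 1 + n) = mcoeff A n"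
proof -
  have "mcoeff (mfps_var k * A) (axis k 1 + n) =
      (\<Sum>(a, b) \<in> {(axis k 1, n)}. mcoeff (mfps_var k) a * mcoeff A b)"
    unfolding mcoeff_mult
    by (rule sum.mono_neutral_right) (auto simp: finite_antidiagonal mfps_var_def split: if_splits)
  then show ?thesis by (simp add: mfps_var_def)
qed

text \<open>This serves to drop the factor \<open>mfps_var k\<close> from \<open>q_series\<close>,
  turning membership in the image into integrality of the exponential.\<close>

lemma mfps_var_mult_cancel: "mfps_var k * A = mfps_var k * B \<Longrightarrow> A = B"
  by (rule mfps_eqI) (metis mcoeff_var_mult)

lemma scalar_product_axis: "scalar_product v (axis k m :: nat ^ 'd :: finite) = v $ k * m"
  by (simp add: scalar_product_def axis_nat_nth if_distrib cong: if_cong)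

lemma fact_ratio_axis:
  "fact_ratio e f (axis k m) = univ_ratio (map (\<lambda>v. v $ k) e) (map (\<lambda>v. v $ k) f) m"
  by (simp add: fact_ratio_def univ_ratio_def scalar_product_axis comp_def)

lemma sum_list_vec_nth: "sum_list xs $ k = (\<Sum>v\<leftarrow>xs. v $ k)"
  by (induction xs) auto

lemma univ_ratio_nonzero: "univ_ratio as bs n \<noteq> 0"
  by (auto simp: univ_ratio_def prod_list_zero_iff)

section \<open>Finiteness of the set of primes\<close>

text \<open>The common shape of both claims: \<open>w\<close> is the weighted combination of
  harmonic numbers in the first and the harmonic number of \<open>L\<close> in the second. The
  condition on \<open>w (axis k 1)\<close> makes the linear coefficient of the quotient nonzero, and
  beyond \<open>N\<close> the denominator of \<open>w (axis k p)\<close> contains \<open>p\<close>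
  at most once.\<close>

lemma finite_primes_exp_integral:
  fixes e f :: "(nat ^ 'd :: finite) list" and w :: "nat ^ 'd \<Rightarrow> rat"
  assumes int: "\<And>n. fact_ratio e f n \<in> \<int>"
    and less: "sum_list f $ k < sum_list e $ k"
    and w0: "w 0 = 0" and w1: "w (axis k 1) \<noteq> 0"
    and wp: "\<And>p. prime p \<Longrightarrow> N < p \<Longrightarrow> of_nat p * w (axis k p) \<in> padic_ints p"
  shows "finite {p. prime p \<and>
    mfps_exp (Abs_mfps (\<lambda>n. fact_ratio e f n * w n) / F_series e f) \<in> padic_int_series p}"
    (is "finite {p. prime p \<and> mfps_exp (?G / ?F) \<in> _}")
proof -
  define as bs where "as = map (\<lambda>v. v $ k) e" and "bs = map (\<lambda>v. v $ k) f"
  define h g u where "h = mfps_axis k (?G / ?F)" and "g = mfps_axis k ?G" and "u = mfps_axis k ?F"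
  have "?G / ?F * ?F = ?G"
    using mfps_mult_inverse[of ?F]
    by (simp add: divide_mfps_def mcoeff_series_0 mult.assoc mult.commute[of "inverse ?F"])
  then have hu: "h * u = g" by (metis h_def u_def g_def mfps_axis_mult)
  have g: "fps_nth g m = univ_ratio as bs m * w (axis k m)" for m
    by (simp add: g_def mfps_axis_nth fact_ratio_axis as_def bs_def)
  have u: "fps_nth u m = fact_ratio e f (axis k m)" for m
    by (simp add: u_def mfps_axis_nth F_series_def)
  have u0: "fps_nth u 0 = 1"
    using mcoeff_series_0(1)[of e f] by (simp add: u_def mfps_axis_nth axis_nat_0)
  have h0: "fps_nth h 0 = 0"
  proof -
    have "fps_nth (h * u) 0 = 0" using hu g[of 0] w0 by (simp add: axis_nat_0)
    then show ?thesis using u0 by simp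
  qed
  have less': "sum_list bs < sum_list as"
    using less by (simp add: as_def bs_def sum_list_vec_nth)
  have g1: "fps_nth g 1 \<noteq> 0" using g[of 1] w1 univ_ratio_nonzero by simp
  have "fps_nth g 1 ^ p / fact p \<in> padic_ints p"
    if p: "prime p" "N < p" "sum_list as + sum_list bs < p"
      and y: "mfps_exp (?G / ?F) \<in> padic_int_series p" for p
  proof (rule exp_integral_imp_linear_power[OF p(1) h0 _ hu u0])
    show "fps_nth (fps_compose (fps_exp 1) h) j \<in> padic_ints p" for j
      using y by (simp add: h_def mfps_axis_nth padic_int_series_def mfps_exp_def
          flip: mfps_axis_compose)
    show "fps_nth u j \<in> padic_ints p" for j
      using u int padic_ints_Ints[OF p(1)] by simp
    \<comment> \<open>One factor \<open>p\<close> of the ratio is handed over to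
      \<open>w\<close>.\<close>
    have "fps_nth g p = (univ_ratio as bs p / of_nat p) * (of_nat p * w (axis k p))"
      using g p by simp
    then show "fps_nth g p \<in> padic_ints p"
      using padic_ints_mult[OF p(1) univ_ratio_prime[OF p(1,3) less'] wp[OF p(1,2)]] by simp
  qed
  then have bad: "fps_nth g 1 ^ p / fact p \<in> padic_ints p \<or> p \<le> N \<or> p \<le> sum_list as + sum_list bs"
    if "prime p" "mfps_exp (?G / ?F) \<in> padic_int_series p" for p
    using that by (meson not_le)
  have "{p. prime p \<and> mfps_exp (?G / ?F) \<in> padic_int_series p} \<subseteq>
      {..N} \<union> {..sum_list as + sum_list bs} \<union>
      {p. prime p \<and> fps_nth g 1 ^ p / fact p \<in> padic_ints p}"
    using bad by blast
  then show ?thesis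
    using finite_primes_power_over_fact[OF g1] by (meson finite_UnI finite_atMost finite_subset)
qed

theorem theorem3:
  fixes e f :: "(nat ^ 'd :: finite) list" and k :: 'd
  assumes "0 \<notin> set e" and "0 \<notin> set f" and "set e \<inter> set f = {}"
    and "\<And>n. fact_ratio e f n \<in> \<int>"
    and "sum_list e $ k > sum_list f $ k"
  shows "finite {p :: nat. prime p \<and> q_series e f k \<in> (*) (mfps_var k) ` padic_int_series p} \<and>
    (\<forall>L \<in> E_set e f. L $ k \<ge> 1 \<longrightarrow>
       finite {p :: nat. prime p \<and> qL_series L e f \<in> padic_int_series p})"
proof (intro conjI ballI impI)
  have [simp]: "scalar_product v 0 = 0" for v :: "nat ^ 'd"
    by (simp add: scalar_product_def)
  have [simp]: "harmonic 0 = 0" by (simp add: harmonic_def)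
  define as bs where "as = map (\<lambda>v. v $ k) e" and "bs = map (\<lambda>v. v $ k) f"
  have less: "sum_list bs < sum_list as"
    using assms(5) by (simp add: as_def bs_def sum_list_vec_nth)
  have int: "univ_ratio as bs n \<in> \<int>" for n
    using assms(4)[of "axis k n"] by (simp add: fact_ratio_axis as_def bs_def)
  define w :: "nat ^ 'd \<Rightarrow> rat" where "w n =
     (\<Sum>v\<leftarrow>e. of_nat (v $ k) * harmonic (scalar_product v n)) -
     (\<Sum>v\<leftarrow>f. of_nat (v $ k) * harmonic (scalar_product v n))" for n
  have w: "w (axis k m) = (\<Sum>a\<leftarrow>as. of_nat a * harmonic (a * m)) -
      (\<Sum>b\<leftarrow>bs. of_nat b * harmonic (b * m))" for m
    by (simp add: w_def as_def bs_def scalar_product_axis comp_def)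
  have "finite {p. prime p \<and>
    mfps_exp (Abs_mfps (\<lambda>n. fact_ratio e f n * w n) / F_series e f) \<in> padic_int_series p}"
  \<comment> \<open>Primes beyond this bound exceed every entry \<open>a\<close>, so that
    \<open>a * p < p\<^sup>2\<close>, as the estimate for harmonic numbers demands.\<close>
  proof (rule finite_primes_exp_integral[where N = "sum_list as + sum_list bs", OF assms(4,5)])
    show "w 0 = 0" using w[of 0] by (simp add: axis_nat_0)
    show "w (axis k 1) \<noteq> 0" using w[of 1] sum_harmonic_less[OF int less] by simp
  next
    fix p :: nat assume p: "prime p" "sum_list as + sum_list bs < p"
    have small: "a * p < p\<^sup>2" if "a \<in> set as \<union> set bs" for a
      using that p(2) member_le_sum_list[of a as] member_le_sum_list[of a bs]
      by (auto simp: power2_eq_square)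
    have "(\<Sum>a\<leftarrow>xs. of_nat a * (of_nat p * harmonic (a * p))) \<in> padic_ints p"
      if "set xs \<subseteq> set as \<union> set bs" for xs
      using that small p(1)
      by (intro padic_ints_sum_list padic_ints_mult padic_ints_of_nat padic_ints_prime_mult_harmonic)
         auto
    from padic_ints_diff[OF p(1) this[of as] this[of bs]]
    have "(\<Sum>a\<leftarrow>as. of_nat a * (of_nat p * harmonic (a * p))) -
      (\<Sum>b\<leftarrow>bs. of_nat b * (of_nat p * harmonic (b * p))) \<in> padic_ints p"
      by simp
    then show "of_nat p * w (axis k p) \<in> padic_ints p"
      unfolding w right_diff_distrib sum_list_const_mult[symmetric]
      by (simp only: mult.left_commute)
  qed
  moreover have "G_series e f k = Abs_mfps (\<lambda>n. fact_ratio e f n * w n)"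
    by (simp add: G_series_def w_def)
  ultimately have fin: "finite {p. prime p \<and> mfps_exp (G_series e f k / F_series e f) \<in> padic_int_series p}"
    by simp
  show "finite {p. prime p \<and> q_series e f k \<in> (*) (mfps_var k) ` padic_int_series p}"
    by (rule finite_subset[OF _ fin]) (auto simp: q_series_def dest: mfps_var_mult_cancel)
next
  fix L assume L: "L \<in> E_set e f" "1 \<le> L $ k"
  show "finite {p. prime p \<and> qL_series L e f \<in> padic_int_series p}"
    unfolding qL_series_def GL_series_def
  \<comment> \<open>For \<open>p > L $ k\<close> the index \<open>L $ k * p\<close> of the harmonic
    number stays below \<open>p\<^sup>2\<close>; nonvanishing in degree 1 is immediate because
    \<open>L $ k\<close> is positive.\<close>
  proof (rule finite_primes_exp_integral[where N = "L $ k", OF assms(4,5)])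
    show "harmonic (scalar_product L 0) = 0"
      by (simp add: scalar_product_def harmonic_def)
    have "harmonic (L $ k) > 0" unfolding harmonic_def using L(2) by (intro sum_pos) auto
    then show "harmonic (scalar_product L (axis k 1)) \<noteq> 0" by (simp add: scalar_product_axis)
  next
    fix p :: nat assume "prime p" "L $ k < p"
    then show "of_nat p * harmonic (scalar_product L (axis k p)) \<in> padic_ints p"
      by (intro padic_ints_prime_mult_harmonic) (auto simp: scalar_product_axis power2_eq_square)
  qed
qed

end
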